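(* $z_{14,3}=1/2$.
   Context: $K_n^r$ denotes the complete $r$-uniform hypergraph on $n$ vertices. Given an edge-coloring $c$ (an arbitrary assignment of colors to edges) of $K_n^r$, let $z(n,r,c,s)$ be the fraction of the $n$ vertices that are incident with at least one edge of color $s$, and let $z(n,r,c)$ be the maximum of $z(n,r,c,s)$ over all colors $s$ appearing in $c$. Let $z_k(n,r)$ be the minimum of $z(n,r,c)$ over all edge-colorings $c$ of $K_n^r$ that use at most $k$ colors, and let $z_{k,r}=\inf_{n\ge r} z_k(n,r)$. *)

theory Defs
  imports Complex_Main "HOL-Library.Ramsey"
begin

text \<open>The complete r-uniform hypergraph on the vertex set \<^term>\<open>{..<n}\<close> has edge set
  \<^term>\<open>nsets {..<n} r\<close>. Colors are natural numbers; only finitely many are ever used,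
  so this is no restriction.\<close>

definition complete_edges :: "nat \<Rightarrow> nat \<Rightarrow> nat set set" where
  "complete_edges n r = nsets {..<n} r"

definition incident_vertices :: "nat \<Rightarrow> nat \<Rightarrow> (nat set \<Rightarrow> nat) \<Rightarrow> nat \<Rightarrow> nat set" where
  "incident_vertices n r c s = {v \<in> {..<n}. \<exists>e \<in> complete_edges n r. v \<in> e \<and> c e = s}"

definition z_color :: "nat \<Rightarrow> nat \<Rightarrow> (nat set \<Rightarrow> nat) \<Rightarrow> nat \<Rightarrow> real" where
  "z_color n r c s = real (card (incident_vertices n r c s)) / real n"

definition z_coloring :: "nat \<Rightarrow> nat \<Rightarrow> (nat set \<Rightarrow> nat) \<Rightarrow> real" where
  "z_coloring n r c = Max (z_color n r c ` (c ` complete_edges n r))"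

definition colorings :: "nat \<Rightarrow> nat \<Rightarrow> nat \<Rightarrow> (nat set \<Rightarrow> nat) set" where
  "colorings k n r = {c. card (c ` complete_edges n r) \<le> k}"

definition z_min :: "nat \<Rightarrow> nat \<Rightarrow> nat \<Rightarrow> real" where
  "z_min k n r = Min (z_coloring n r ` colorings k n r)"

definition z_inf :: "nat \<Rightarrow> nat \<Rightarrow> real" where
  "z_inf k r = (INF n\<in>{r..}. z_min k n r)"

text \<open>\<^term>\<open>Max\<close>, \<^term>\<open>Min\<close> and the infimum above are taken over sets on which they
  are meaningful. In particular, although \<^term>\<open>colorings k n r\<close> is infinite (values
  outside the edge set are arbitrary), only finitely many values occur in the minimum.\<close>

lemma finite_complete_edges: "finite (complete_edges n r)"
  by (simp add: complete_edges_def finite_imp_finite_nsets)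

lemma complete_edges_nonempty: "r \<le> n \<Longrightarrow> complete_edges n r \<noteq> {}"
  by (simp add: complete_edges_def nsets_eq_empty_iff)

lemma z_coloring_in:
  assumes "r \<le> n"
  shows "z_coloring n r c \<in> (\<lambda>i. real i / real n) ` {..n}"
proof -
  have "z_coloring n r c \<in> z_color n r c ` (c ` complete_edges n r)"
    unfolding z_coloring_def using assms
    by (intro Max_in) (auto simp: finite_complete_edges complete_edges_nonempty)
  then obtain s where s: "z_coloring n r c = z_color n r c s" by blast
  have "card (incident_vertices n r c s) \<le> card {..<n}"
    by (rule card_mono) (auto simp: incident_vertices_def)
  then show ?thesis by (auto simp: s z_color_def)
qed

lemma finite_z_values: "r \<le> n \<Longrightarrow> finite (z_coloring n r ` colorings k n r)"
  by (rule finite_subset[of _ "(\<lambda>i. real i / real n) ` {..n}"]) (use z_coloring_in in auto)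

lemma colorings_nonempty: "1 \<le> k \<Longrightarrow> colorings k n r \<noteq> {}"
proof -
  assume "1 \<le> k"
  moreover have "card ((\<lambda>_. 0::nat) ` complete_edges n r) \<le> card {0::nat}"
    by (rule card_mono) auto
  ultimately have "(\<lambda>_. 0) \<in> colorings k n r" by (simp add: colorings_def)
  then show ?thesis by blast
qed

lemma bdd_below_z_min: "1 \<le> k \<Longrightarrow> bdd_below ((\<lambda>n. z_min k n r) ` {r..})"
proof (rule bdd_belowI2)
  fix n assume "1 \<le> k" "n \<in> {r..}"
  then have "z_min k n r \<in> z_coloring n r ` colorings k n r"
    unfolding z_min_def by (intro Min_in finite_z_values) (auto simp: colorings_nonempty)
  then obtain c where "z_min k n r = z_coloring n r c" by blast
  then show "0 \<le> z_min k n r" using z_coloring_in[of r n c] \<open>n \<in> {r..}\<close> by auto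
qed

end

theory Submission
  imports Defs
begin

text \<open>Giving the edges at most \<open>k\<close> colors amounts to covering all triples of vertices by at most
  \<open>k\<close> sets, namely the sets of vertices incident with each color. So the question is how large the
  blocks of a covering of the triples by 14 blocks have to be.

  Blocks of relative size \<open>1/2\<close> suffice: the 14 planes of the affine space over the field with two
  elements, of dimension 3, are 4-subsets of an 8-point set, and any three points lie on a plane
  (\<open>affine_planes_cover\<close>). Assigning to a triple a plane through it gives a coloring with
  \<open>n = 8\<close> (\<open>z_min_le_of_cover\<close>).

  Conversely, suppose that all blocks contain less than half of the vertices. This is the setting
  of the Schoenheim bound. If every point of a set lies in at least \<open>m \<ge> 1\<close> blocks, each smaller
  than half of that set, then double counting of incidences gives strictly more than \<open>2 * m\<close>
  blocks (\<open>card_blocks_gt\<close>). Deleting a point from the vertex set and from all the blocks through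
  it leaves blocks that are still smaller than half of what remains, so the count can be used at
  three levels: a point outside a pair lies in one of the blocks through the pair, hence there are at
  least 3 blocks through each pair, hence at least 7 through each point, hence at least 15
  in total (\<open>card_triple_cover_ge\<close>). The integer rounding at each level is what excludes 14.\<close>

section \<open>Covering triples by sets smaller than half\<close>

text \<open>Both sides count incidences of points and blocks; the strict inequality is kept because every
  block falls short of half of \<open>V\<close>.\<close>

lemma card_blocks_gt:
  fixes A :: "'s \<Rightarrow> 'v set"
  assumes "finite V" "finite S" "V \<noteq> {}" "m \<ge> 1"
    and sub: "\<And>s. s \<in> S \<Longrightarrow> A s \<subseteq> V"
    and small: "\<And>s. s \<in> S \<Longrightarrow> 2 * card (A s) < card V"
    and deg: "\<And>v. v \<in> V \<Longrightarrow> m \<le> card {s \<in> S. v \<in> A s}"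
  shows "2 * m < card S"
proof -
  obtain v where "v \<in> V" using \<open>V \<noteq> {}\<close> by blast
  with deg[of v] \<open>m \<ge> 1\<close> have "{s \<in> S. v \<in> A s} \<noteq> {}" by force
  then have "S \<noteq> {}" by blast
  have "card V * m \<le> (\<Sum>v\<in>V. card {s \<in> S. v \<in> A s})"
    using sum_bounded_below[of V m "\<lambda>v. card {s \<in> S. v \<in> A s}"] deg by simp
  also have "\<dots> = (\<Sum>s\<in>S. card {v \<in> V. v \<in> A s})"
    using sum.swap_restrict[OF \<open>finite V\<close> \<open>finite S\<close>, of "\<lambda>_ _. 1::nat" "\<lambda>v s. v \<in> A s"] by simp
  also have "\<dots> = (\<Sum>s\<in>S. card (A s))"
    using sub by (intro sum.cong arg_cong[of _ _ card]) auto
  finally have "2 * (card V * m) \<le> (\<Sum>s\<in>S. 2 * card (A s))"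
    by (simp add: sum_distrib_left [symmetric])
  also have "\<dots> < (\<Sum>s\<in>S. card V)"
    using \<open>finite S\<close> \<open>S \<noteq> {}\<close> small by (intro sum_strict_mono) auto
  finally have "card V * (2 * m) < card V * card S" by (simp add: ac_simps)
  then show ?thesis by simp
qed

text \<open>The number 15 arises by iterating \<open>m \<mapsto> 2 * m + 1\<close> three times from 1, once each for
  the blocks through a pair, for those through a point and for all blocks.\<close>

lemma card_triple_cover_ge:
  fixes A :: "'s \<Rightarrow> 'v set"
  assumes "finite V" "finite S" "3 \<le> card V"
    and sub: "\<And>s. s \<in> S \<Longrightarrow> A s \<subseteq> V"
    and small: "\<And>s. s \<in> S \<Longrightarrow> 2 * card (A s) < card V"
    and cover: "\<And>e. e \<in> nsets V 3 \<Longrightarrow> \<exists>s\<in>S. e \<subseteq> A s"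
  shows "15 \<le> card S"
proof -
  have fin: "finite (A s)" if "s \<in> S" for s
    using sub[OF that] \<open>finite V\<close> finite_subset by blast
  have pair: "3 \<le> card {s \<in> S. x \<in> A s \<and> y \<in> A s}" if "x \<in> V" "y \<in> V" "x \<noteq> y" for x y
  proof -
    have cV: "card (V - {x, y}) = card V - 2"
      using that \<open>finite V\<close> by (simp add: card_Diff_subset)
    have "2 * 1 < card {s \<in> S. x \<in> A s \<and> y \<in> A s}"
    proof (rule card_blocks_gt[where V = "V - {x, y}" and A = "\<lambda>s. A s - {x, y}"])
      show "V - {x, y} \<noteq> {}" using cV \<open>3 \<le> card V\<close> by force
    next
      fix s assume "s \<in> {s \<in> S. x \<in> A s \<and> y \<in> A s}"
      then have s: "s \<in> S" "x \<in> A s" "y \<in> A s" by auto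
      then have "card (A s - {x, y}) = card (A s) - 2"
        using fin \<open>x \<noteq> y\<close> by (simp add: card_Diff_subset)
      moreover have "2 \<le> card (A s)"
        using s fin \<open>x \<noteq> y\<close> card_mono[of "A s" "{x, y}"] by simp
      ultimately show "2 * card (A s - {x, y}) < card (V - {x, y})"
        using small[OF s(1)] cV by linarith
    next
      fix v assume v: "v \<in> V - {x, y}"
      then have "{x, y, v} \<in> nsets V 3" using that by (auto simp: nsets_def)
      then obtain s where "s \<in> S" "{x, y, v} \<subseteq> A s" using cover by blast
      then have "{s \<in> {s \<in> S. x \<in> A s \<and> y \<in> A s}. v \<in> A s - {x, y}} \<noteq> {}" using v by blast
      then show "1 \<le> card {s \<in> {s \<in> S. x \<in> A s \<and> y \<in> A s}. v \<in> A s - {x, y}}"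
        using \<open>finite S\<close> by (simp add: Suc_le_eq card_gt_0_iff)
    qed (use sub \<open>finite V\<close> \<open>finite S\<close> in auto)
    then show ?thesis by simp
  qed
  have point: "7 \<le> card {s \<in> S. x \<in> A s}" if "x \<in> V" for x
  proof -
    have cV: "card (V - {x}) = card V - 1" using that by simp
    have "2 * 3 < card {s \<in> S. x \<in> A s}"
    proof (rule card_blocks_gt[where V = "V - {x}" and A = "\<lambda>s. A s - {x}"])
      show "V - {x} \<noteq> {}" using cV \<open>3 \<le> card V\<close> by force
    next
      fix s assume "s \<in> {s \<in> S. x \<in> A s}"
      then have s: "s \<in> S" "x \<in> A s" by auto
      then have "card (A s - {x}) = card (A s) - 1" "1 \<le> card (A s)"
        using fin by (auto simp: Suc_le_eq card_gt_0_iff)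
      then show "2 * card (A s - {x}) < card (V - {x})"
        using small[OF s(1)] cV by linarith
    next
      fix y assume y: "y \<in> V - {x}"
      then have "{s \<in> {s \<in> S. x \<in> A s}. y \<in> A s - {x}} = {s \<in> S. x \<in> A s \<and> y \<in> A s}" by blast
      then show "3 \<le> card {s \<in> {s \<in> S. x \<in> A s}. y \<in> A s - {x}}"
        using pair[of x y] that y by auto
    qed (use sub \<open>finite V\<close> \<open>finite S\<close> in auto)
    then show ?thesis by simp
  qed
  have "2 * 7 < card S"
    using assms point by (intro card_blocks_gt[where V = V and A = A]) auto
  then show ?thesis by simp
qed

section \<open>Colorings and coverings\<close>

lemma z_coloring_ge_half:
  assumes "3 \<le> n" "c \<in> colorings 14 n 3"
  shows "1 / 2 \<le> z_coloring n 3 c"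
proof (rule ccontr)
  let ?E = "complete_edges n 3" and ?A = "incident_vertices n 3 c"
  assume "\<not> 1 / 2 \<le> z_coloring n 3 c"
  then have "Max (z_color n 3 c ` c ` ?E) < 1 / 2" by (simp add: z_coloring_def)
  then have lt: "z_color n 3 c s < 1 / 2" if "s \<in> c ` ?E" for s
    using that finite_complete_edges[of n 3] by (subst (asm) Max_less_iff) auto
  have "15 \<le> card (c ` ?E)"
  proof (rule card_triple_cover_ge[where V = "{..<n}" and A = ?A])
    show "2 * card (?A s) < card {..<n}" if "s \<in> c ` ?E" for s
      using lt[OF that] \<open>3 \<le> n\<close> by (simp add: z_color_def field_simps)
    show "\<exists>s\<in>c ` ?E. e \<subseteq> ?A s" if "e \<in> nsets {..<n} 3" for e
    proof
      show "e \<subseteq> ?A (c e)" using that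
        by (auto simp: incident_vertices_def complete_edges_def nsets_def)
    qed (use that in \<open>simp add: complete_edges_def\<close>)
  qed (use \<open>3 \<le> n\<close> in \<open>auto simp: finite_complete_edges incident_vertices_def\<close>)
  then show False using assms(2) by (simp add: colorings_def)
qed

lemma z_min_le_of_cover:
  assumes "r \<le> n" "n > 0"
    and B: "\<And>i. i < k \<Longrightarrow> finite (B i)" "\<And>i. i < k \<Longrightarrow> card (B i) \<le> m"
    and cover: "\<And>e. e \<in> nsets {..<n} r \<Longrightarrow> \<exists>i<k. e \<subseteq> B i"
  shows "z_min k n r \<le> real m / real n"
proof -
  obtain c where c: "c e < k" "e \<subseteq> B (c e)" if "e \<in> complete_edges n r" for e
    using cover unfolding complete_edges_def by metis
  have "card (c ` complete_edges n r) \<le> card {..<k}"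
    using c(1) by (intro card_mono) auto
  then have "c \<in> colorings k n r" by (simp add: colorings_def)
  then have "z_min k n r \<le> z_coloring n r c"
    unfolding z_min_def using finite_z_values[OF \<open>r \<le> n\<close>] by (intro Min_le) auto
  also have "z_coloring n r c \<le> real m / real n"
    unfolding z_coloring_def
  proof (rule Max.boundedI)
    fix z assume "z \<in> z_color n r c ` c ` complete_edges n r"
    then obtain s where s: "s \<in> c ` complete_edges n r" and z: "z = z_color n r c s" by blast
    have "s < k" using s c(1) by blast
    have "incident_vertices n r c s \<subseteq> B s"
      using c(2) unfolding incident_vertices_def by blast
    then have "card (incident_vertices n r c s) \<le> m"
      using B[OF \<open>s < k\<close>] card_mono le_trans by blast
    then show "z \<le> real m / real n"
      using \<open>n > 0\<close> by (simp add: z z_color_def divide_right_mono)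
  qed (use \<open>r \<le> n\<close> in \<open>auto simp: finite_complete_edges complete_edges_nonempty\<close>)
  finally show ?thesis .
qed

section \<open>The planes of the affine 3-space over the field with two elements\<close>

text \<open>A number below 8 stands for the vector of its binary digits. Each row consists of the two
  parallel planes on which one of the seven nonzero linear forms is 0 and 1.\<close>

definition affine_planes :: "nat list list" where
  "affine_planes =
    [[0,2,4,6], [1,3,5,7],
     [0,1,4,5], [2,3,6,7],
     [0,3,4,7], [1,2,5,6],
     [0,1,2,3], [4,5,6,7],
     [0,2,5,7], [1,3,4,6],
     [0,1,6,7], [2,3,4,5],
     [0,3,5,6], [1,2,4,7]]"

lemma affine_planes_cover:
  assumes "a < 8" "b < 8" "c < 8"
  shows "\<exists>p \<in> set affine_planes. {a, b, c} \<subseteq> set p"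
proof -
  have "\<forall>a \<in> set [0..<8]. \<forall>b \<in> set [0..<8]. \<forall>c \<in> set [0..<8].
      \<exists>p \<in> set affine_planes. a \<in> set p \<and> b \<in> set p \<and> c \<in> set p"
    by code_simp
  then show ?thesis using assms by simp
qed

theorem mainTheorem11: "z_inf 14 3 = 1 / 2"
proof (rule antisym)
  have "z_min 14 8 3 \<le> real 4 / real 8"
  proof (rule z_min_le_of_cover[where B = "\<lambda>i. set (affine_planes ! i)"])
    have "\<forall>p \<in> set affine_planes. length p = 4" by (simp add: affine_planes_def)
    moreover have len: "length affine_planes = 14" by (simp add: affine_planes_def)
    ultimately show "card (set (affine_planes ! i)) \<le> 4" if "i < 14" for i
      using that card_length nth_mem by metis
    show "\<exists>i<14. e \<subseteq> set (affine_planes ! i)" if e: "e \<in> nsets {..<8} 3" for e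
    proof -
      obtain x y z where "e = {x, y, z}" "e \<subseteq> {..<8}"
        using e by (auto simp: nsets_def card_3_iff)
      then obtain p where "p \<in> set affine_planes" "e \<subseteq> set p"
        using affine_planes_cover[of x y z] by auto
      then show ?thesis using len by (metis in_set_conv_nth)
    qed
  qed auto
  moreover have "z_inf 14 3 \<le> z_min 14 8 3"
    unfolding z_inf_def by (rule cINF_lower) (auto intro: bdd_below_z_min)
  ultimately show "z_inf 14 3 \<le> 1 / 2" by simp
next
  have "1 / 2 \<le> z_min 14 n 3" if "3 \<le> n" for n
    unfolding z_min_def using that
    by (intro Min.boundedI) (use z_coloring_ge_half in \<open>force simp: finite_z_values colorings_nonempty\<close>)+
  then show "1 / 2 \<le> z_inf 14 3"
    unfolding z_inf_def by (intro cINF_greatest) auto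
qed

end
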